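(* Let $C_{2n+1}$ be the odd circuit on $2n+1$ nodes and $\overline{C_{2n+1}}$ its complementary graph. Consider the weighted odd circuit $(C_{2n+1},w)$ and its complement $(\overline{C_{2n+1}},w)$, with node weights $w\in\mathbb{R}_+^{2n+1}$ and where, for each of the two graphs, the edge weights satisfy $w_{ij}\ge\max\{w_i,w_j\}$ for all edges $ij$ of that graph. Then $$\mathrm{rk}_H(C_{2n+1},w)\le 3\quad\text{and}\quad \mathrm{rk}_H(\overline{C_{2n+1}},w)\le n+1.$$ Moreover, equality holds in the unweighted case: $\mathrm{rk}_H(C_{2n+1})=3$ and $\mathrm{rk}_H(\overline{C_{2n+1}})=n+1$.
   Context: For a finite simple graph $G=(V,E)$ with $V=[m]$, node weights $w\in\mathbb{R}^V_+$ and edge weights $w_{ij}$ ($ij\in E$): $\alpha(G,w)$ is the maximum of $w(S)=\sum_{i\in S}w_i$ over stable sets $S$ of $G$. For $I\subseteq V$ write $x^I=\prod_{i\in I}x_i$ and $(1-x)^I=\prod_{i\in I}(1-x_i)$. For an integer $t\ge 1$, $$H_t=\Big\{\sum_{T\subseteq V,\ |T|\le t}\ \sum_{I\subseteq T}c_{T,I}\,x^I(1-x)^{T\setminus I}:\ c_{T,I}\ge 0\Big\}\subseteq\mathbb{R}[x_1,\dots,x_m].$$ Set $p_{G,w}=\sum_{i\in V}w_ix_i-\sum_{ij\in E}w_{ij}x_ix_j$ and $p_{\mathrm{han}}^{(t)}(G,w)=\inf\{\lambda\in\mathbb{R}:\lambda-p_{G,w}\in H_t\}$. The Handelman rank $\mathrm{rk}_H(G,w)$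 is the smallest integer $t\ge1$ for which $p_{\mathrm{han}}^{(t)}(G,w)=\alpha(G,w)$; equivalently, the smallest $t$ for which $\alpha(G,w)-p_{G,w}\in H_t$. In the unweighted case ($w_i=1$ for all $i\in V$ and $w_{ij}=1$ for all $ij\in E$) one writes $\mathrm{rk}_H(G)$.
   Formalization: The equality rk_H of the complement of C_{2n+1} = n+1 is proved for n ≥ 2 only: for n = 1 the complement of C_3 is three isolated nodes and its rank is 1, not 2; all other claims are proved for every n ≥ 1. *)

theory Defs
  imports "HOL-Library.Poly_Mapping" "HOL-Library.Extended_Real" "HOL-Library.Extended_Nat"
begin

text \<open>A graph is given by its vertex set \<open>V\<close> and its set \<open>E\<close> of edges, each edge being a
  two-element subset of \<open>V\<close>. Edge weights are functions on edges, hence symmetric.\<close>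

definition simple_graph :: "'v set \<Rightarrow> 'v set set \<Rightarrow> bool" where
  "simple_graph V E \<longleftrightarrow> finite V \<and> (\<forall>e\<in>E. e \<subseteq> V \<and> card e = 2)"

definition stable_set :: "'v set \<Rightarrow> 'v set set \<Rightarrow> 'v set \<Rightarrow> bool" where
  "stable_set V E S \<longleftrightarrow> S \<subseteq> V \<and> (\<forall>i\<in>S. \<forall>j\<in>S. {i, j} \<notin> E)"

definition stability_number :: "'v set \<Rightarrow> 'v set set \<Rightarrow> ('v \<Rightarrow> real) \<Rightarrow> real" where
  "stability_number V E w = Max {(\<Sum>i\<in>S. w i) | S. stable_set V E S}"

definition complement_edges :: "'v set \<Rightarrow> 'v set set \<Rightarrow> 'v set set" where
  "complement_edges V E = {e. e \<subseteq> V \<and> card e = 2 \<and> e \<notin> E}"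

text \<open>Real polynomials with variables indexed by \<open>'v\<close>: finitely supported maps from exponent
  vectors to coefficients, with the convolution product.\<close>

type_synonym 'v mpoly = "('v \<Rightarrow>\<^sub>0 nat) \<Rightarrow>\<^sub>0 real"

definition const_poly :: "real \<Rightarrow> 'v mpoly" where
  "const_poly a = Poly_Mapping.single 0 a"

definition var_poly :: "'v \<Rightarrow> 'v mpoly" where
  "var_poly i = Poly_Mapping.single (Poly_Mapping.single i 1) 1"

definition handelman_set :: "'v set \<Rightarrow> nat \<Rightarrow> 'v mpoly set" where
  "handelman_set V t =
    {(\<Sum>T\<in>{T. T \<subseteq> V \<and> card T \<le> t}. \<Sum>I\<in>Pow T.
        const_poly (c T I) * (\<Prod>i\<in>I. var_poly i) * (\<Prod>i\<in>T - I. 1 - var_poly i))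
     | c. \<forall>T I. 0 \<le> c T I}"

definition graph_poly ::
  "'v set \<Rightarrow> 'v set set \<Rightarrow> ('v \<Rightarrow> real) \<Rightarrow> ('v set \<Rightarrow> real) \<Rightarrow> 'v mpoly" where
  "graph_poly V E w u =
    (\<Sum>i\<in>V. const_poly (w i) * var_poly i)
    - (\<Sum>e\<in>E. const_poly (u e) * (\<Prod>i\<in>e. var_poly i))"

text \<open>The infimum is taken in the extended reals, so that it is \<open>\<infinity>\<close> if no \<open>l\<close> is feasible,
  which happens for \<open>t = 1\<close> as soon as some edge has nonzero weight.\<close>

definition handelman_bound ::
  "'v set \<Rightarrow> 'v set set \<Rightarrow> ('v \<Rightarrow> real) \<Rightarrow> ('v set \<Rightarrow> real) \<Rightarrow> nat \<Rightarrow> ereal" where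
  "handelman_bound V E w u t =
    Inf {ereal l | l. const_poly l - graph_poly V E w u \<in> handelman_set V t}"

text \<open>The rank is \<open>\<infinity>\<close> if no order \<open>t\<close> is exact; thus a finite upper bound on it includes
  the existence of such an order.\<close>

definition handelman_rank ::
  "'v set \<Rightarrow> 'v set set \<Rightarrow> ('v \<Rightarrow> real) \<Rightarrow> ('v set \<Rightarrow> real) \<Rightarrow> enat" where
  "handelman_rank V E w u =
    Inf {enat t | t. 1 \<le> t \<and> handelman_bound V E w u t = ereal (stability_number V E w)}"

definition edge_weights_dominate :: "'v set set \<Rightarrow> ('v \<Rightarrow> real) \<Rightarrow> ('v set \<Rightarrow> real) \<Rightarrow> bool" where
  "edge_weights_dominate E w u \<longleftrightarrow> (\<forall>i j. {i, j} \<in> E \<longrightarrow> max (w i) (w j) \<le> u {i, j})"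

definition circuit_nodes :: "nat \<Rightarrow> nat set" where
  "circuit_nodes m = {0..<m}"

definition circuit_edges :: "nat \<Rightarrow> nat set set" where
  "circuit_edges m = {{i, (i + 1) mod m} | i. i < m}"

lemma simple_graph_circuit:
  assumes "3 \<le> m"
  shows "simple_graph (circuit_nodes m) (circuit_edges m)"
proof -
  have "i \<noteq> (i + 1) mod m" if "i < m" for i
    using that assms by (cases "i + 1 = m") auto
  then show ?thesis
    using assms by (auto simp: simple_graph_def circuit_nodes_def circuit_edges_def card_2_iff)
qed

lemma simple_graph_complement:
  "finite V \<Longrightarrow> simple_graph V (complement_edges V E)"
  by (auto simp: simple_graph_def complement_edges_def)

end

(*
Upper bounds: for a node v, a - p is split as (1 - x_v) (a - p)|_{x_v = 0} + x_v (a - p)|_{x_v = 1},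
so the rank grows by at most one when passing from the graphs without v and without the closed
neighbourhood of v to the whole graph. For both graphs these two smaller graphs are perfect, and
a weighted clique cover reduces membership to single cliques K, where the clique inequality is
nonnegative on the cube and hence has order |K|: edges for the circuit (order 2), stable sets of a
path on 2n nodes for its complement (order n).

Lower bounds: the linear functional 1 -> 1, x_i -> 1/t, x^I -> 0 for |I| > 1 is nonnegative on H_t
and maps p to |V|/t in the unweighted case, so t must be at least |V| / alpha.
*)

theory Submission
  imports Defs
begin

text \<open>The lower bound on the edge weights enters in two strengths. Splitting at
  \<open>v\<close> needs \<open>w j \<le> u {v, j}\<close>: at \<open>x_v = 1\<close> a neighbour
  \<open>j\<close> contributes \<open>(u {v, j} - w j) x_j\<close>, and \<open>j\<close> can be
  discarded only if this coefficient is nonnegative. On the two smaller graphs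
  \<open>min (w i) (w j) \<le> u {i, j}\<close> is enough, and this weaker condition survives the
  subtraction of a clique inequality, so it is the one carried through the inductions. The clique
  covers are built by hand, and their total weight must not exceed the target constant. On a path, a
  stable set of the same weight is grown along with the cover. In the complement of a path, stable
  sets have at most two nodes, so a constant is large enough as soon as it bounds every node and
  every nonadjacent pair.\<close>

lemma const_poly_0 [simp]: "const_poly 0 = 0"
  by (simp add: const_poly_def)

lemma const_poly_1 [simp]: "const_poly 1 = 1"
  by (simp add: const_poly_def)

lemma const_poly_add: "const_poly (a + b) = const_poly a + const_poly b"
  by (simp add: const_poly_def single_add)

lemma const_poly_diff: "const_poly (a - b) = const_poly a - const_poly b"
  by (simp add: const_poly_def single_diff)

lemma const_poly_mult: "const_poly (a * b) = const_poly a * const_poly b"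
  by (simp add: const_poly_def mult_single)

subsection \<open>Evaluation of polynomials\<close>

text \<open>Membership in the cone is proved by identities between formal polynomials. Values at
  points serve only to exclude it: at indicator vectors of stable sets, and along the diagonal near
  0.\<close>

definition monomial_eval :: "('v \<Rightarrow> real) \<Rightarrow> ('v \<Rightarrow>\<^sub>0 nat) \<Rightarrow> real" where
  "monomial_eval x m = (\<Prod>i\<in>Poly_Mapping.keys m. x i ^ Poly_Mapping.lookup m i)"

definition poly_eval :: "('v \<Rightarrow> real) \<Rightarrow> 'v mpoly \<Rightarrow> real" where
  "poly_eval x f =
     (\<Sum>m\<in>Poly_Mapping.keys f. Poly_Mapping.lookup f m * monomial_eval x m)"

lemma monomial_eval_superset:
  assumes "finite K" "Poly_Mapping.keys m \<subseteq> K"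
  shows "monomial_eval x m = (\<Prod>i\<in>K. x i ^ Poly_Mapping.lookup m i)"
  unfolding monomial_eval_def
  using assms by (intro prod.mono_neutral_left) (auto simp: in_keys_iff)

lemma monomial_eval_add: "monomial_eval x (m + m') = monomial_eval x m * monomial_eval x m'"
proof -
  let ?K = "Poly_Mapping.keys m \<union> Poly_Mapping.keys m'"
  have "Poly_Mapping.keys (m + m') \<subseteq> ?K"
    by (rule keys_add)
  then show ?thesis
    by (simp add: monomial_eval_superset[of ?K] lookup_add power_add prod.distrib)
qed

text \<open>Cancellation can make the support of a sum smaller than the union of the supports. Over
  a common superset the additional coefficients are 0, and sums can be compared term by
  term.\<close>

lemma poly_eval_superset:
  assumes "finite K" "Poly_Mapping.keys f \<subseteq> K"
  shows "poly_eval x f = (\<Sum>m\<in>K. Poly_Mapping.lookup f m * monomial_eval x m)"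
  unfolding poly_eval_def
  using assms by (intro sum.mono_neutral_left) (auto simp: in_keys_iff)

lemma poly_eval_single: "poly_eval x (Poly_Mapping.single m a) = a * monomial_eval x m"
  by (subst poly_eval_superset[of "{m}"]) (auto simp: lookup_single)

lemma poly_eval_0 [simp]: "poly_eval x 0 = 0"
  by (simp add: poly_eval_def)

lemma poly_eval_add: "poly_eval x (f + g) = poly_eval x f + poly_eval x g"
proof -
  let ?K = "Poly_Mapping.keys f \<union> Poly_Mapping.keys g"
  have "Poly_Mapping.keys (f + g) \<subseteq> ?K"
    by (rule keys_add)
  then show ?thesis
    by (simp add: poly_eval_superset[of ?K] lookup_add distrib_right sum.distrib)
qed

lemma poly_eval_uminus: "poly_eval x (- f) = - poly_eval x f"
  using poly_eval_add[of x f "- f"] by simp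

lemma poly_eval_diff: "poly_eval x (f - g) = poly_eval x f - poly_eval x g"
  using poly_eval_add[of x f "- g"] by (simp add: poly_eval_uminus)

lemma poly_eval_sum: "poly_eval x (\<Sum>a\<in>A. F a) = (\<Sum>a\<in>A. poly_eval x (F a))"
  by (induction A rule: infinite_finite_induct) (simp_all add: poly_eval_add)

lemma poly_eval_mult: "poly_eval x (f * g) = poly_eval x f * poly_eval x g"
proof -
  \<comment> \<open>Writing both factors as sums of terms reduces multiplicativity to
    \<open>monomial_eval_add\<close>.\<close>
  have expand: "h = (\<Sum>m\<in>Poly_Mapping.keys h. Poly_Mapping.single m (Poly_Mapping.lookup h m))"
    for h :: "'a mpoly"
    by (rule poly_mapping_eqI)
      (auto simp: lookup_sum lookup_single when_def in_keys_iff)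
  have "f * g = (\<Sum>m\<in>Poly_Mapping.keys f. \<Sum>m'\<in>Poly_Mapping.keys g.
      Poly_Mapping.single (m + m') (Poly_Mapping.lookup f m * Poly_Mapping.lookup g m'))"
    by (subst expand[of f], subst expand[of g]) (simp only: sum_product mult_single)
  then have "poly_eval x (f * g) = (\<Sum>m\<in>Poly_Mapping.keys f. \<Sum>m'\<in>Poly_Mapping.keys g.
      (Poly_Mapping.lookup f m * Poly_Mapping.lookup g m') * monomial_eval x (m + m'))"
    by (simp only: poly_eval_sum poly_eval_single)
  then show ?thesis
    by (simp add: monomial_eval_add poly_eval_def sum_product mult_ac)
qed

lemma poly_eval_const [simp]: "poly_eval x (const_poly a) = a"
  by (simp add: const_poly_def poly_eval_single monomial_eval_def)

lemma poly_eval_1 [simp]: "poly_eval x 1 = 1"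
  using poly_eval_const[of x 1] by simp

lemma poly_eval_var [simp]: "poly_eval x (var_poly i) = x i"
  by (simp add: var_poly_def poly_eval_single monomial_eval_def)

lemma poly_eval_prod: "poly_eval x (\<Prod>a\<in>A. F a) = (\<Prod>a\<in>A. poly_eval x (F a))"
  by (induction A rule: infinite_finite_induct) (simp_all add: poly_eval_mult)

lemmas poly_eval_simps =
  poly_eval_add poly_eval_diff poly_eval_sum poly_eval_mult poly_eval_prod

subsection \<open>The Handelman cone\<close>

lemma handelman_set_0: "0 \<in> handelman_set V t"
  unfolding handelman_set_def by (rule CollectI, rule exI[of _ "\<lambda>_ _. 0"]) simp

lemma handelman_set_add:
  assumes "f \<in> handelman_set V t" "g \<in> handelman_set V t"
  shows "f + g \<in> handelman_set V t"
proof -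
  from assms obtain c d where
    "\<forall>T I. 0 \<le> c T I" "\<forall>T I. 0 \<le> d T I"
    "f = (\<Sum>T\<in>{T. T \<subseteq> V \<and> card T \<le> t}. \<Sum>I\<in>Pow T.
        const_poly (c T I) * (\<Prod>i\<in>I. var_poly i) * (\<Prod>i\<in>T - I. 1 - var_poly i))"
    "g = (\<Sum>T\<in>{T. T \<subseteq> V \<and> card T \<le> t}. \<Sum>I\<in>Pow T.
        const_poly (d T I) * (\<Prod>i\<in>I. var_poly i) * (\<Prod>i\<in>T - I. 1 - var_poly i))"
    unfolding handelman_set_def by blast
  then show ?thesis
    unfolding handelman_set_def
    by (intro CollectI exI[of _ "\<lambda>T I. c T I + d T I"])
      (simp add: const_poly_add distrib_right sum.distrib)
qed

lemma handelman_set_scale: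
  assumes "f \<in> handelman_set V t" "0 \<le> r"
  shows "const_poly r * f \<in> handelman_set V t"
proof -
  from assms obtain c where
    "\<forall>T I. 0 \<le> c T I"
    "f = (\<Sum>T\<in>{T. T \<subseteq> V \<and> card T \<le> t}. \<Sum>I\<in>Pow T.
        const_poly (c T I) * (\<Prod>i\<in>I. var_poly i) * (\<Prod>i\<in>T - I. 1 - var_poly i))"
    unfolding handelman_set_def by blast
  with \<open>0 \<le> r\<close> show ?thesis
    unfolding handelman_set_def
    by (intro CollectI exI[of _ "\<lambda>T I. r * c T I"])
      (simp add: const_poly_mult sum_distrib_left mult.assoc)
qed

lemma handelman_set_sum:
  assumes "\<And>a. a \<in> A \<Longrightarrow> F a \<in> handelman_set V t"
  shows "(\<Sum>a\<in>A. F a) \<in> handelman_set V t"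
  using assms
  by (induction A rule: infinite_finite_induct)
    (auto intro: handelman_set_add handelman_set_0)

lemma handelman_set_generator:
  assumes "finite V" "I \<union> J \<subseteq> V" "I \<inter> J = {}" "card (I \<union> J) \<le> t"
  shows "(\<Prod>i\<in>I. var_poly i) * (\<Prod>i\<in>J. 1 - var_poly i) \<in> handelman_set V t"
proof -
  \<comment> \<open>All coefficients vanish except the one for \<open>T = I \<union> J\<close>,
    \<open>K = I\<close>; disjointness gives \<open>T - I = J\<close>.\<close>
  define c :: "'a set \<Rightarrow> 'a set \<Rightarrow> real"
    where "c T K = (if T = I \<union> J then if K = I then 1 else 0 else 0)" for T K
  have *: "const_poly (if b then p else q) * f * g =
      (if b then const_poly p * f * g else const_poly q * f * g)" for b p q and f g :: "'a mpoly"
    by simp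
  have "finite (I \<union> J)" and "I \<union> J - I = J"
    using assms finite_subset by auto
  then have "(\<Prod>i\<in>I. var_poly i) * (\<Prod>i\<in>J. 1 - var_poly i) =
      (\<Sum>T\<in>{T. T \<subseteq> V \<and> card T \<le> t}. \<Sum>K\<in>Pow T.
        const_poly (c T K) * (\<Prod>i\<in>K. var_poly i) * (\<Prod>i\<in>T - K. 1 - var_poly i))"
    using assms unfolding c_def
    by (subst sum.remove[of _ "I \<union> J"], simp, simp, subst sum.remove[of _ I]) auto
  moreover have "\<forall>T K. 0 \<le> c T K"
    by (simp add: c_def)
  ultimately show ?thesis
    unfolding handelman_set_def by blast
qed

text \<open>Hides the coefficient family: a property closed under addition need only be checked on
  nonnegative multiples of single products.\<close>

lemma handelman_set_induct [consumes 2, case_names zero add generator]: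
  assumes "f \<in> handelman_set V t" "finite V"
    and "P 0" "\<And>f g. P f \<Longrightarrow> P g \<Longrightarrow> P (f + g)"
    and "\<And>r I J. 0 \<le> r \<Longrightarrow> I \<union> J \<subseteq> V \<Longrightarrow> I \<inter> J = {} \<Longrightarrow> card (I \<union> J) \<le> t \<Longrightarrow>
      P (const_poly r * ((\<Prod>i\<in>I. var_poly i) * (\<Prod>i\<in>J. 1 - var_poly i)))"
  shows "P f"
proof -
  from assms(1) obtain c where c: "\<forall>T I. 0 \<le> c T I" and
    f: "f = (\<Sum>T\<in>{T. T \<subseteq> V \<and> card T \<le> t}. \<Sum>I\<in>Pow T.
        const_poly (c T I) * (\<Prod>i\<in>I. var_poly i) * (\<Prod>i\<in>T - I. 1 - var_poly i))"
    unfolding handelman_set_def by blast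
  have sum: "P (\<Sum>a\<in>A. F a)" if "\<And>a. a \<in> A \<Longrightarrow> P (F a)" for A and F :: "'a set \<Rightarrow> 'a mpoly"
    using that by (induction A rule: infinite_finite_induct) (auto intro: assms)
  have gen: "P (const_poly (c T I) * (\<Prod>i\<in>I. var_poly i) * (\<Prod>i\<in>T - I. 1 - var_poly i))"
    if "T \<subseteq> V" "card T \<le> t" "I \<subseteq> T" for T I
  proof -
    have "I \<union> (T - I) = T" using that by blast
    then show ?thesis
      using assms(5)[of "c T I" I "T - I"] c that by (simp add: mult.assoc)
  qed
  show ?thesis
    unfolding f by (intro sum gen) auto
qed

lemma handelman_set_mono:
  assumes "f \<in> handelman_set V t" "finite W" "V \<subseteq> W" "t \<le> s"
  shows "f \<in> handelman_set W s"
proof -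
  have "finite V" using assms finite_subset by blast
  with assms(1) show ?thesis
    by (induction rule: handelman_set_induct)
      (use assms in \<open>auto intro!: handelman_set_0 handelman_set_add handelman_set_scale
        handelman_set_generator\<close>)
qed

lemma handelman_set_const:
  assumes "finite V" "0 \<le> r"
  shows "const_poly r \<in> handelman_set V t"
  using handelman_set_scale[OF handelman_set_generator[of V "{}" "{}" t] assms(2)] assms by simp

lemma handelman_set_prod:
  assumes "finite V" "I \<subseteq> V" "card I \<le> t"
  shows "(\<Prod>i\<in>I. var_poly i) \<in> handelman_set V t"
  using handelman_set_generator[of V I "{}" t] assms by simp

text \<open>A fresh variable lengthens each generator by one factor. Since
  \<open>v \<notin> V\<close>, the two index sets stay disjoint and no square appears.\<close>

lemma handelman_set_mult_var:
  assumes "f \<in> handelman_set V t" "finite V" "v \<notin> V"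
  shows "var_poly v * f \<in> handelman_set (insert v V) (Suc t)"
  using assms(1,2)
proof (induction rule: handelman_set_induct)
  case (generator r I J)
  have "finite (I \<union> J)" "v \<notin> I" "v \<notin> J"
    using assms generator finite_subset by blast+
  then have "(\<Prod>i\<in>insert v I. var_poly i) * (\<Prod>i\<in>J. 1 - var_poly i)
      \<in> handelman_set (insert v V) (Suc t)"
    using assms generator by (intro handelman_set_generator) (auto simp: card_insert_if)
  from handelman_set_scale[OF this \<open>0 \<le> r\<close>] show ?case
    using \<open>finite (I \<union> J)\<close> \<open>v \<notin> I\<close> by (simp add: mult_ac)
qed (auto simp: distrib_left intro: handelman_set_0 handelman_set_add)

lemma handelman_set_mult_one_minus_var:
  assumes "f \<in> handelman_set V t" "finite V" "v \<notin> V"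
  shows "(1 - var_poly v) * f \<in> handelman_set (insert v V) (Suc t)"
  using assms(1,2)
proof (induction rule: handelman_set_induct)
  case (generator r I J)
  have "finite (I \<union> J)" "v \<notin> I" "v \<notin> J"
    using assms generator finite_subset by blast+
  then have "(\<Prod>i\<in>I. var_poly i) * (\<Prod>i\<in>insert v J. 1 - var_poly i)
      \<in> handelman_set (insert v V) (Suc t)"
    using assms generator by (intro handelman_set_generator) (auto simp: card_insert_if)
  from handelman_set_scale[OF this \<open>0 \<le> r\<close>] show ?case
    using \<open>finite (I \<union> J)\<close> \<open>v \<notin> J\<close> by (simp add: mult_ac)
qed (auto simp: distrib_left intro: handelman_set_0 handelman_set_add)

section \<open>Linear functionals that are nonnegative on the cone\<close>

lemma poly_eval_handelman_set_nonneg: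
  assumes "f \<in> handelman_set V t" "finite V" "\<And>i. i \<in> V \<Longrightarrow> 0 \<le> x i \<and> x i \<le> 1"
  shows "0 \<le> poly_eval x f"
  using assms(1,2)
proof (induction rule: handelman_set_induct)
  case (generator r I J)
  have "0 \<le> (\<Prod>i\<in>I. x i)" "0 \<le> (\<Prod>i\<in>J. 1 - x i)"
    using generator assms(3) by (auto intro!: prod_nonneg)
  then show ?case
    using generator by (simp add: poly_eval_simps)
qed (simp_all add: poly_eval_simps)

text \<open>The functional \<open>f \<mapsto> f(0) + (1/t) \<Sum>\<^sub>i \<partial>\<^sub>i f(0)\<close> is nonnegative on \<open>H\<^sub>t\<close>; it is computed
  along the diagonal.\<close>

lemma handelman_set_diagonal_derivative:
  assumes "f \<in> handelman_set V t" "finite V"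
  shows "\<exists>D. ((\<lambda>e. poly_eval (\<lambda>_. e) f) has_real_derivative D) (at 0) \<and>
    0 \<le> real t * poly_eval (\<lambda>_. 0) f + D"
  using assms
proof (induction rule: handelman_set_induct)
  case zero
  show ?case by (auto intro!: exI[of _ 0])
next
  case (add f g)
  then obtain D D' where
    "((\<lambda>e. poly_eval (\<lambda>_. e) f) has_real_derivative D) (at 0)"
    "((\<lambda>e. poly_eval (\<lambda>_. e) g) has_real_derivative D') (at 0)"
    "0 \<le> real t * poly_eval (\<lambda>_. 0) f + D" "0 \<le> real t * poly_eval (\<lambda>_. 0) g + D'"
    by blast
  then show ?case
    by (intro exI[of _ "D + D'"]) (auto simp: poly_eval_simps distrib_left intro!: DERIV_add)
next
  case (generator r I J)
  have "finite I" "finite J" using generator assms finite_subset by blast+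
  then have card: "card J \<le> t"
    using generator by (simp add: card_Un_disjoint)
  \<comment> \<open>The powers of 0 act as case distinctions, with \<open>0 ^ 0 = 1\<close>: the
    first term survives only for \<open>card I = 1\<close>, the second only for
    \<open>card I = 0\<close>. In the latter case the value \<open>r\<close> at 0, taken
    \<open>t\<close> times, pays for \<open>r * card J\<close>.\<close>
  define D where "D = r * (real (card I) * 0 ^ (card I - 1) - 0 ^ card I * real (card J))"
  have "((\<lambda>e::real. r * (e ^ card I * (1 - e) ^ card J)) has_real_derivative D) (at 0)"
    unfolding D_def by (auto intro!: derivative_eq_intros simp: mult_ac)
  moreover have "0 \<le> real t * (r * (0 ^ card I * (1 - 0) ^ card J)) + D"
  proof (cases "card I = 0")
    case True
    have "r * real (card J) \<le> r * real t"
      using card generator by (intro mult_left_mono) auto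
    with True show ?thesis by (simp add: D_def mult_ac)
  next
    case False
    then show ?thesis using generator by (simp add: D_def zero_power)
  qed
  ultimately show ?case
    by (intro exI[of _ D]) (simp add: poly_eval_simps)
qed

subsection \<open>Bounds on the Handelman rank\<close>

lemma finite_edges:
  assumes "simple_graph V E"
  shows "finite E"
  using assms by (intro finite_subset[of E "Pow V"]) (auto simp: simple_graph_def)

lemma edge_cases:
  assumes "simple_graph V E" "e \<in> E"
  obtains i j where "e = {i, j}" "i \<noteq> j" "i \<in> V" "j \<in> V"
proof -
  from assms have "card e = 2" "e \<subseteq> V" by (auto simp: simple_graph_def)
  then show thesis using that by (auto simp: card_2_iff)
qed

lemma finite_stable_weights:
  assumes "finite V"
  shows "finite {(\<Sum>i\<in>S. w i) | S. stable_set V E S}"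
proof -
  have "{(\<Sum>i\<in>S. w i) | S. stable_set V E S} \<subseteq> (\<lambda>S. \<Sum>i\<in>S. w i) ` Pow V"
    by (auto simp: stable_set_def)
  then show ?thesis using assms finite_subset by blast
qed

lemma stable_set_weight_le:
  assumes "finite V" "stable_set V E S"
  shows "(\<Sum>i\<in>S. w i) \<le> stability_number V E w"
  unfolding stability_number_def
  using finite_stable_weights[OF assms(1)] assms(2) by (intro Max_ge) blast+

lemma stability_number_attained:
  assumes "finite V"
  obtains S where "stable_set V E S" "stability_number V E w = (\<Sum>i\<in>S. w i)"
proof -
  have "stable_set V E {}" by (simp add: stable_set_def)
  then have "{(\<Sum>i\<in>S. w i) | S. stable_set V E S} \<noteq> {}" by blast
  from Max_in[OF finite_stable_weights[OF assms] this] show thesis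
    using that unfolding stability_number_def by blast
qed

lemma poly_eval_graph_poly:
  "poly_eval x (graph_poly V E w u) =
    (\<Sum>i\<in>V. w i * x i) - (\<Sum>e\<in>E. u e * (\<Prod>i\<in>e. x i))"
  by (simp add: graph_poly_def poly_eval_simps)

text \<open>At the indicator vector of a maximum weight stable set all edge monomials vanish, so the
  graph polynomial takes the value \<open>stability_number V E w\<close>, while elements of the cone
  are nonnegative on the cube.\<close>

lemma stability_number_le_feasible:
  assumes "simple_graph V E" "const_poly l - graph_poly V E w u \<in> handelman_set V t"
  shows "stability_number V E w \<le> l"
proof -
  have "finite V" using assms by (simp add: simple_graph_def)
  then obtain S where S: "stable_set V E S" "stability_number V E w = (\<Sum>i\<in>S. w i)"
    by (rule stability_number_attained)
  define x :: "'a \<Rightarrow> real" where "x i = (if i \<in> S then 1 else 0)" for i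
  have "(\<Prod>i\<in>e. x i) = 0" if "e \<in> E" for e
    using assms(1) that
  proof (rule edge_cases)
    fix i j assume "e = {i, j}" "i \<noteq> j"
    then show ?thesis using S(1) that by (auto simp: x_def stable_set_def)
  qed
  moreover have "(\<Sum>i\<in>V. w i * x i) = (\<Sum>i\<in>S. w i)"
    using \<open>finite V\<close> S(1) unfolding x_def stable_set_def
    by (intro sum.mono_neutral_cong_right) auto
  ultimately have "poly_eval x (const_poly l - graph_poly V E w u) = l - (\<Sum>i\<in>S. w i)"
    by (simp add: poly_eval_diff poly_eval_graph_poly)
  moreover have "0 \<le> poly_eval x (const_poly l - graph_poly V E w u)"
    using poly_eval_handelman_set_nonneg[OF assms(2) \<open>finite V\<close>] by (simp add: x_def)
  ultimately show ?thesis using S(2) by simp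
qed

text \<open>The stability number is then feasible and no smaller constant is, so the infimum is
  attained there and \<open>t\<close> is an exact order.\<close>

lemma handelman_rank_le:
  assumes "simple_graph V E" "1 \<le> t"
    and "const_poly (stability_number V E w) - graph_poly V E w u \<in> handelman_set V t"
  shows "handelman_rank V E w u \<le> enat t"
proof -
  have "handelman_bound V E w u t = ereal (stability_number V E w)"
    unfolding handelman_bound_def
    using assms stability_number_le_feasible[OF assms(1)]
    by (intro antisym Inf_lower Inf_greatest) auto
  then show ?thesis
    unfolding handelman_rank_def using \<open>1 \<le> t\<close> by (intro Inf_lower) auto
qed

text \<open>On the diagonal the polynomial is \<open>l - |V| e + |E| e^2\<close>, with value
  \<open>l\<close> and derivative \<open>- |V|\<close> at 0; the edges contribute only to second
  order.\<close>

lemma card_le_mult_feasible: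
  assumes "simple_graph V E"
    and "const_poly l - graph_poly V E (\<lambda>_. 1) (\<lambda>_. 1) \<in> handelman_set V t"
  shows "real (card V) \<le> real t * l"
proof -
  have "finite V" using assms by (simp add: simple_graph_def)
  from handelman_set_diagonal_derivative[OF assms(2) this] obtain D where
    D: "((\<lambda>e. poly_eval (\<lambda>_. e) (const_poly l - graph_poly V E (\<lambda>_. 1) (\<lambda>_. 1)))
      has_real_derivative D) (at 0)"
    and nonneg: "0 \<le> real t * poly_eval (\<lambda>_. 0)
      (const_poly l - graph_poly V E (\<lambda>_. 1) (\<lambda>_. 1)) + D"
    by blast
  have eval: "poly_eval (\<lambda>_. e) (const_poly l - graph_poly V E (\<lambda>_. 1) (\<lambda>_. 1)) =
      l - (real (card V) * e - real (card E) * e\<^sup>2)" for e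
  proof -
    have "(\<Sum>s\<in>E. e ^ card s) = (\<Sum>s\<in>E. e\<^sup>2)"
      using assms(1) by (intro sum.cong) (auto simp: simple_graph_def)
    then show ?thesis by (simp add: poly_eval_diff poly_eval_graph_poly)
  qed
  have "((\<lambda>e::real. l - (real (card V) * e - real (card E) * e\<^sup>2))
      has_real_derivative - real (card V)) (at 0)"
    by (auto intro!: derivative_eq_intros)
  with D have "D = - real (card V)"
    unfolding eval by (rule DERIV_unique)
  with nonneg show ?thesis by (simp add: eval)
qed

text \<open>An exact order is defined through an infimum, which need not be attained. Hence the
  inequality is proved for every feasible constant and then passed to the infimum.\<close>

lemma handelman_rank_ge:
  assumes "simple_graph V E"
    and "\<And>t. real (card V) \<le> real t * stability_number V E (\<lambda>_. 1) \<Longrightarrow> k \<le> t"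
  shows "enat k \<le> handelman_rank V E (\<lambda>_. 1) (\<lambda>_. 1)"
  unfolding handelman_rank_def
proof (intro Inf_greatest, clarify)
  fix t :: nat
  assume t: "1 \<le> t" and bound: "handelman_bound V E (\<lambda>_. 1) (\<lambda>_. 1) t =
    ereal (stability_number V E (\<lambda>_. 1))"
  have "ereal (real (card V) / real t) \<le> handelman_bound V E (\<lambda>_. 1) (\<lambda>_. 1) t"
    unfolding handelman_bound_def
    using t card_le_mult_feasible[OF assms(1)]
    by (intro Inf_greatest) (auto simp: divide_le_eq mult.commute)
  then have "real (card V) \<le> real t * stability_number V E (\<lambda>_. 1)"
    using t by (simp add: bound divide_le_eq mult.commute)
  then show "enat k \<le> enat t" using assms(2) by simp
qed

subsection \<open>Cliques and vertex splitting\<close>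

definition induced_edges :: "'v set set \<Rightarrow> 'v set \<Rightarrow> 'v set set" where
  "induced_edges E W = {e \<in> E. e \<subseteq> W}"

lemma simple_graph_induced:
  assumes "simple_graph V E" "W \<subseteq> V"
  shows "simple_graph W (induced_edges E W)"
  using assms finite_subset by (auto simp: simple_graph_def induced_edges_def)

text \<open>The polynomial is affine in \<open>x_v\<close>. Separating the part free of
  \<open>x_v\<close> from the slope makes both substitutions \<open>x_v = 0\<close> and
  \<open>x_v = 1\<close> available.\<close>

lemma graph_poly_insert:
  assumes "simple_graph (insert v V) E" "v \<notin> V"
  shows "graph_poly (insert v V) E w u =
    graph_poly V (induced_edges E V) w u +
    var_poly v * (const_poly (w v) -
      (\<Sum>j\<in>{j\<in>V. {v, j} \<in> E}. const_poly (u {v, j}) * var_poly j))"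
proof -
  let ?N = "{j\<in>V. {v, j} \<in> E}" and ?F = "induced_edges E V"
  have fin: "finite V" "finite E"
    using assms finite_edges[OF assms(1)] by (auto simp: simple_graph_def)
  have E: "E = ?F \<union> (\<lambda>j. {v, j}) ` ?N"
  proof -
    have "e \<in> (\<lambda>j. {v, j}) ` ?N" if e: "e \<in> E" "\<not> e \<subseteq> V" for e
      using assms(1) e(1) by (rule edge_cases) (use e assms(2) in \<open>auto simp: insert_commute\<close>)
    then show ?thesis by (auto simp: induced_edges_def)
  qed
  have "?F \<inter> (\<lambda>j. {v, j}) ` ?N = {}"
    using assms(2) by (auto simp: induced_edges_def)
  moreover have "inj_on (\<lambda>j. {v, j}) ?N"
    using assms(2) by (auto simp: inj_on_def doubleton_eq_iff)
  ultimately have "(\<Sum>e\<in>E. const_poly (u e) * (\<Prod>i\<in>e. var_poly i)) =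
      (\<Sum>e\<in>?F. const_poly (u e) * (\<Prod>i\<in>e. var_poly i)) +
      (\<Sum>j\<in>?N. const_poly (u {v, j}) * (\<Prod>i\<in>{v, j}. var_poly i))"
    using fin by (subst E, subst sum.union_disjoint)
      (auto simp: induced_edges_def sum.reindex)
  moreover have "(\<Sum>j\<in>?N. const_poly (u {v, j}) * (\<Prod>i\<in>{v, j}. var_poly i)) =
      var_poly v * (\<Sum>j\<in>?N. const_poly (u {v, j}) * var_poly j)"
    unfolding sum_distrib_left
  proof (intro sum.cong refl)
    fix j assume "j \<in> ?N"
    then have "v \<noteq> j" using assms(2) by auto
    then show "const_poly (u {v, j}) * (\<Prod>i\<in>{v, j}. var_poly i) =
        var_poly v * (const_poly (u {v, j}) * var_poly j)"
      by (simp add: mult_ac)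
  qed
  ultimately show ?thesis
    using fin assms(2) by (simp add: graph_poly_def algebra_simps)
qed

lemma graph_poly_induced:
  assumes "simple_graph V E" "W \<subseteq> V"
  shows "graph_poly V E w u = graph_poly W (induced_edges E W) w u +
    (\<Sum>i\<in>V - W. const_poly (w i) * var_poly i) -
    (\<Sum>e\<in>E - induced_edges E W. const_poly (u e) * (\<Prod>i\<in>e. var_poly i))"
proof -
  have "finite V" "finite E"
    using assms finite_edges by (auto simp: simple_graph_def)
  moreover have "induced_edges E W \<subseteq> E"
    by (auto simp: induced_edges_def)
  ultimately show ?thesis
    using assms(2) by (simp add: graph_poly_def sum.subset_diff[of W V]
        sum.subset_diff[of "induced_edges E W" E])
qed

text \<open>At \<open>x\<^sub>v = 1\<close> the weights of the neighbours of \<open>v\<close> are absorbed by their edges to \<open>v\<close>.\<close>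

lemma handelman_set_vertex_split:
  assumes graph: "simple_graph (insert v V) E" and v: "v \<notin> V"
    and N: "N = {j\<in>V. {v, j} \<in> E}"
    and dom: "\<And>j. j \<in> N \<Longrightarrow> w j \<le> u {v, j}"
    and pos: "\<And>e. e \<in> E \<Longrightarrow> 0 \<le> u e"
    and del: "const_poly a - graph_poly V (induced_edges E V) w u \<in> handelman_set V t"
    and nbh: "const_poly (a - w v) - graph_poly (V - N) (induced_edges E (V - N)) w u
      \<in> handelman_set V t"
    and size: "N \<noteq> {} \<Longrightarrow> 1 \<le> t" "induced_edges E V \<noteq> {} \<Longrightarrow> 2 \<le> t"
  shows "const_poly a - graph_poly (insert v V) E w u \<in> handelman_set (insert v V) (Suc t)"
proof -
  have fin: "finite V" using graph by (simp add: simple_graph_def)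
  let ?F = "induced_edges E V"
  define P where "P = const_poly a - graph_poly V ?F w u"
  define Q where "Q = const_poly (a - w v) - graph_poly (V - N) (induced_edges E (V - N)) w u"
  \<comment> \<open>\<open>R\<close> and \<open>X\<close> are the surplus at \<open>x_v = 1\<close>:
    what the edges from \<open>v\<close> leave over after absorbing the linear terms of
    \<open>N\<close>, and the remaining edges that meet \<open>N\<close>. Their monomials need order
    1 and order 2, which is what \<open>size\<close> provides.\<close>
  define R where "R = (\<Sum>j\<in>N. const_poly (u {v, j} - w j) * var_poly j)"
  define X where "X = (\<Sum>e\<in>?F - induced_edges E (V - N). const_poly (u e) * (\<Prod>i\<in>e. var_poly i))"
  have F: "simple_graph V ?F" by (rule simple_graph_induced[OF graph]) auto
  have ind: "induced_edges ?F (V - N) = induced_edges E (V - N)"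
    by (auto simp: induced_edges_def)
  have VN: "V - (V - N) = N" using N by auto
  have red: "graph_poly V ?F w u = graph_poly (V - N) (induced_edges E (V - N)) w u +
      (\<Sum>j\<in>N. const_poly (w j) * var_poly j) - X"
    using graph_poly_induced[OF F, of "V - N" w u] unfolding ind VN X_def by simp
  have "const_poly a - graph_poly (insert v V) E w u =
      (1 - var_poly v) * P + var_poly v * (Q + R + X)"
    unfolding graph_poly_insert[OF graph v] N[symmetric] P_def Q_def R_def red
    by (simp add: const_poly_diff algebra_simps sum_subtractf sum_distrib_left)
  moreover have "R \<in> handelman_set V t"
    unfolding R_def
  proof (intro handelman_set_sum handelman_set_scale)
    fix j assume "j \<in> N"
    then show "var_poly j \<in> handelman_set V t"
      using handelman_set_prod[of V "{j}" t] fin N size by auto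
  qed (use dom in auto)
  moreover have "X \<in> handelman_set V t"
    unfolding X_def
  proof (intro handelman_set_sum handelman_set_scale)
    fix e assume "e \<in> ?F - induced_edges E (V - N)"
    then show "(\<Prod>i\<in>e. var_poly i) \<in> handelman_set V t"
      using F size fin by (intro handelman_set_prod) (auto simp: simple_graph_def)
  qed (use pos in \<open>auto simp: induced_edges_def\<close>)
  ultimately show ?thesis
    using del nbh fin v unfolding P_def[symmetric] Q_def[symmetric]
    by (simp add: handelman_set_add handelman_set_mult_var handelman_set_mult_one_minus_var)
qed

section \<open>Clique inequalities and their subtraction\<close>

definition clique :: "'v set set \<Rightarrow> 'v set \<Rightarrow> bool" where
  "clique E K \<longleftrightarrow> (\<forall>i\<in>K. \<forall>j\<in>K. i \<noteq> j \<longrightarrow> {i, j} \<in> E)"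

text \<open>Splitting off a node leaves the inequality of the smaller clique at
  \<open>x_v = 0\<close>, and the empty graph with constant 0 at \<open>x_v = 1\<close>. Each node
  therefore costs one order, starting from order 0 for the empty clique.\<close>

lemma handelman_set_clique:
  assumes "simple_graph K E" "clique E K"
  shows "1 - graph_poly K E (\<lambda>_. 1) (\<lambda>_. 1) \<in> handelman_set K (card K)"
proof -
  have "finite K" using assms by (simp add: simple_graph_def)
  then show ?thesis using assms
  proof (induction K arbitrary: E rule: finite_induct)
    case empty
    then have "E = {}" by (force simp: simple_graph_def)
    then show ?case
      using handelman_set_const[of "{}" 1 0] by (simp add: graph_poly_def)
  next
    case (insert v K)
    have N: "K = {j\<in>K. {v, j} \<in> E}"
      using insert by (auto simp: clique_def)
    have sub: "simple_graph K (induced_edges E K)"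
      using insert.prems(1) by (rule simple_graph_induced) auto
    have "clique (induced_edges E K) K"
      using insert.prems(2) by (auto simp: clique_def induced_edges_def)
    then have "1 - graph_poly K (induced_edges E K) (\<lambda>_. 1) (\<lambda>_. 1) \<in> handelman_set K (card K)"
      by (rule insert.IH[OF sub])
    moreover have "1 \<le> card K" if "K \<noteq> {}"
      using that insert.hyps(1) by (simp add: Suc_le_eq card_gt_0_iff)
    moreover have "2 \<le> card K" if "induced_edges E K \<noteq> {}"
    proof -
      from that obtain e where "e \<subseteq> K" "card e = 2"
        using sub by (auto simp: simple_graph_def)
      then show ?thesis using card_mono[OF insert.hyps(1)] by metis
    qed
    moreover have "induced_edges E {} = {}"
      using insert.prems(1) by (force simp: induced_edges_def simple_graph_def)
    ultimately have "const_poly 1 - graph_poly (insert v K) E (\<lambda>_. 1) (\<lambda>_. 1)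
        \<in> handelman_set (insert v K) (Suc (card K))"
      by (intro handelman_set_vertex_split[OF insert.prems(1) insert.hyps(2) N])
        (auto simp: graph_poly_def handelman_set_0)
    then show ?case using insert.hyps by simp
  qed
qed

text \<open>One step of a weighted clique cover: \<open>y\<close> times the clique inequality of
  \<open>K\<close> is split off. That inequality contains the edges of \<open>K\<close> with
  coefficient 1, so their weights drop together with the node weights.\<close>

lemma handelman_set_subtract_clique:
  assumes graph: "simple_graph V E" and K: "K \<subseteq> V" "clique E K" "card K \<le> t" and "0 \<le> y"
    and rest: "const_poly (a - y) - graph_poly V E
      (\<lambda>i. if i \<in> K then w i - y else w i) (\<lambda>e. if e \<subseteq> K then u e - y else u e)
      \<in> handelman_set V t"
  shows "const_poly a - graph_poly V E w u \<in> handelman_set V t"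
proof -
  have fin: "finite V" "finite E"
    using graph finite_edges by (auto simp: simple_graph_def)
  let ?F = "induced_edges E K"
  have nodes: "(\<Sum>i\<in>V. const_poly (if i \<in> K then w i - y else w i) * var_poly i) =
      (\<Sum>i\<in>V. const_poly (w i) * var_poly i) - const_poly y * (\<Sum>i\<in>K. var_poly i)"
  proof -
    have "const_poly y * (\<Sum>i\<in>K. var_poly i) =
        (\<Sum>i\<in>V. if i \<in> K then const_poly y * var_poly i else 0)"
      using fin K(1) by (simp add: sum.If_cases sum_distrib_left Int_absorb1)
    then show ?thesis
      unfolding sum_subtractf[symmetric]
      by (simp only:)
        (auto intro!: sum.cong simp: const_poly_diff algebra_simps sum_subtractf[symmetric])
  qed
  have edges: "(\<Sum>e\<in>E. const_poly (if e \<subseteq> K then u e - y else u e) * (\<Prod>i\<in>e. var_poly i)) =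
      (\<Sum>e\<in>E. const_poly (u e) * (\<Prod>i\<in>e. var_poly i)) -
      const_poly y * (\<Sum>e\<in>?F. \<Prod>i\<in>e. var_poly i)"
  proof -
    have "const_poly y * (\<Sum>e\<in>?F. \<Prod>i\<in>e. var_poly i) =
        (\<Sum>e\<in>E. if e \<subseteq> K then const_poly y * (\<Prod>i\<in>e. var_poly i) else 0)"
      using fin by (simp add: sum.If_cases sum_distrib_left induced_edges_def Collect_conj_eq)
    then show ?thesis
      by (simp only:)
        (auto intro!: sum.cong simp: const_poly_diff algebra_simps sum_subtractf[symmetric])
  qed
  have "const_poly y * (1 - graph_poly K ?F (\<lambda>_. 1) (\<lambda>_. 1)) \<in> handelman_set V t"
  proof (intro handelman_set_scale[OF handelman_set_mono[OF handelman_set_clique]])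
    show "clique ?F K" using K by (auto simp: clique_def induced_edges_def)
  qed (use assms fin simple_graph_induced in auto)
  from handelman_set_add[OF rest this] show ?thesis
    unfolding graph_poly_def nodes edges by (simp add: const_poly_diff algebra_simps)
qed

text \<open>Induction on the number of nodes of positive weight in \<open>A\<close> plus the number of nodes of weight
  less than \<open>a\<close> in \<open>B\<close>: the remaining nodes of positive weight in \<open>A\<close> and those of weight \<open>a\<close> in
  \<open>B\<close> form a clique, because two nonadjacent ones would violate \<open>w i + w j \<le> a\<close>.\<close>

lemma handelman_set_cobipartite:
  assumes graph: "simple_graph (A \<union> B) E" and disj: "A \<inter> B = {}"
    and cliques: "clique E A" "clique E B"
    and size: "\<And>K. K \<subseteq> A \<union> B \<Longrightarrow> clique E K \<Longrightarrow> card K \<le> t"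
    and "0 \<le> a"
    and "\<And>i. i \<in> A \<union> B \<Longrightarrow> 0 \<le> w i" "\<And>i. i \<in> A \<union> B \<Longrightarrow> w i \<le> a"
    and "\<And>i j. i \<in> A \<Longrightarrow> j \<in> B \<Longrightarrow> {i, j} \<notin> E \<Longrightarrow> w i + w j \<le> a"
    and "\<And>i j. {i, j} \<in> E \<Longrightarrow> min (w i) (w j) \<le> u {i, j}"
  shows "const_poly a - graph_poly (A \<union> B) E w u \<in> handelman_set (A \<union> B) t"
  using assms(6-)
proof (induction "card {i\<in>A. 0 < w i} + card {j\<in>B. w j < a}" arbitrary: a w u rule: less_induct)
  case less
  note w_nonneg = less.prems(2) and w_le = less.prems(3) and cross = less.prems(4)
    and u_ge = less.prems(5)
  have fin: "finite A" "finite B"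
    using graph by (auto simp: simple_graph_def)
  define P where "P = {i\<in>A. 0 < w i}"
  define Q where "Q = {j\<in>B. w j < a}"
  have finPQ: "finite P" "finite Q"
    using fin by (auto simp: P_def Q_def)
  define K where "K = P \<union> (B - Q)"
  have "K \<subseteq> A \<union> B" by (auto simp: K_def P_def)
  have adj: "{i, j} \<in> E" if "i \<in> P" "j \<in> B - Q" for i j
    using cross[of i j] w_le[of j] that by (fastforce simp: P_def Q_def)
  have "clique E K"
    unfolding clique_def
  proof (intro ballI impI)
    fix i j assume "i \<in> K" "j \<in> K" "i \<noteq> j"
    then show "{i, j} \<in> E"
      using adj[of i j] adj[of j i] cliques
      by (auto simp: K_def clique_def P_def insert_commute)
  qed
  then have "card K \<le> t"
    using size \<open>K \<subseteq> A \<union> B\<close> by blast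
  \<comment> \<open>The largest step that keeps the weights on \<open>P\<close> nonnegative and
    those on \<open>Q\<close> at most \<open>a - y\<close>. If both sets are empty, every weight is
    0 or \<open>a\<close>, and \<open>y = a\<close> finishes the cover.\<close>
  define y where "y = (if P = {} \<and> Q = {} then a else Min (w ` P \<union> (\<lambda>j. a - w j) ` Q))"
  define w' where "w' i = (if i \<in> K then w i - y else w i)" for i
  define u' where "u' e = (if e \<subseteq> K then u e - y else u e)" for e
  have y_le: "y \<le> w i" if "i \<in> P" for i
    using that finPQ by (auto simp: y_def intro!: Min_le)
  have y_le': "y \<le> a - w j" if "j \<in> Q" for j
    using that finPQ by (auto simp: y_def intro!: Min_le)
  have y: "0 \<le> y" "y \<le> a"
  proof -
    have "0 \<le> y \<and> y \<le> a"
    proof (cases "P = {} \<and> Q = {}")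
      case True
      then show ?thesis using less.prems(1) by (simp add: y_def)
    next
      case False
      then have "y \<in> w ` P \<union> (\<lambda>j. a - w j) ` Q"
        using finPQ unfolding y_def by (simp only: if_False) (intro Min_in; auto)
      then show ?thesis
        using w_nonneg w_le by (auto simp: P_def Q_def)
    qed
    then show "0 \<le> y" "y \<le> a" by auto
  qed
  have w'_A: "w' i = (if i \<in> P then w i - y else 0)" if "i \<in> A" for i
    using that disj w_nonneg[of i] by (auto simp: w'_def K_def P_def)
  have w'_B: "w' j = (if j \<in> Q then w j else a - y)" if "j \<in> B" for j
    using that disj w_le[of j] by (auto simp: w'_def K_def P_def Q_def)
  have w'_nonneg: "0 \<le> w' i" if "i \<in> A \<union> B" for i
    using that y y_le[of i] w_nonneg[of i] by (auto simp: w'_A w'_B)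
  have w'_le: "w' i \<le> a - y" if "i \<in> A \<union> B" for i
    using that y y_le'[of i] w_le[of i] by (auto simp: w'_A w'_B)
  \<comment> \<open>If \<open>i \<in> P\<close>, then \<open>j \<in> Q\<close> by
    \<open>adj\<close>, so \<open>w i\<close> drops by \<open>y\<close> exactly as the bound does.
    Otherwise \<open>w' i = 0\<close> and only \<open>w' j \<le> a - y\<close> is needed.\<close>
  have w'_cross: "w' i + w' j \<le> a - y" if "i \<in> A" "j \<in> B" "{i, j} \<notin> E" for i j
    using that cross[of i j] adj[of i j] y_le'[of j] by (auto simp: w'_A w'_B)
  \<comment> \<open>Inside \<open>K\<close> both sides drop by \<open>y\<close>; on any other edge
    the right side is unchanged and the minimum cannot grow.\<close>
  have u'_ge: "min (w' i) (w' j) \<le> u' {i, j}" if "{i, j} \<in> E" for i j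
    using u_ge[OF that] y by (auto simp: w'_def u'_def)
  have "const_poly (a - y) - graph_poly (A \<union> B) E w' u' \<in> handelman_set (A \<union> B) t"
  proof (cases "P = {} \<and> Q = {}")
    case True
    then have "y = a" by (simp add: y_def)
    then have w'_0: "w' i = 0" if "i \<in> A \<union> B" for i
      using that True by (auto simp: w'_A w'_B)
    \<comment> \<open>With all node weights 0, only the edge terms remain, and the condition on the
      minimum says that their coefficients are nonnegative.\<close>
    have "(\<Sum>e\<in>E. const_poly (u' e) * (\<Prod>i\<in>e. var_poly i)) \<in> handelman_set (A \<union> B) t"
    proof (intro handelman_set_sum handelman_set_scale handelman_set_prod)
      fix e assume e: "e \<in> E"
      from graph e obtain i j where ij: "e = {i, j}" "i \<noteq> j" "i \<in> A \<union> B" "j \<in> A \<union> B"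
        by (rule edge_cases)
      then show "0 \<le> u' e" using u'_ge[of i j] e w'_0 by simp
      show "e \<subseteq> A \<union> B" using ij by auto
      have "clique E e" using ij e by (auto simp: clique_def insert_commute)
      then show "card e \<le> t" using size \<open>e \<subseteq> A \<union> B\<close> by blast
    qed (use fin in auto)
    moreover have "(\<Sum>i\<in>A \<union> B. const_poly (w' i) * var_poly i) = 0"
      using w'_0 by (intro sum.neutral) simp
    ultimately show ?thesis by (simp add: graph_poly_def \<open>y = a\<close>)
  next
    case False
    then have y_in: "y \<in> w ` P \<union> (\<lambda>j. a - w j) ` Q"
      using finPQ unfolding y_def by (simp only: if_False) (intro Min_in; auto)
    have P': "{i\<in>A. 0 < w' i} \<subseteq> P" and Q': "{j\<in>B. w' j < a - y} \<subseteq> Q"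
      by (auto simp: w'_A w'_B split: if_splits)
    \<comment> \<open>A node attaining the minimum that defines \<open>y\<close> leaves
      \<open>P\<close> or \<open>Q\<close>.\<close>
    have "{i\<in>A. 0 < w' i} \<subset> P \<or> {j\<in>B. w' j < a - y} \<subset> Q"
      using y_in
    proof
      assume "y \<in> w ` P"
      then obtain i where "i \<in> P" "w' i = 0" by (auto simp: w'_def K_def)
      then show ?thesis using P' by auto
    next
      assume "y \<in> (\<lambda>j. a - w j) ` Q"
      then obtain j where "j \<in> Q" "w' j = a - y" by (auto simp: w'_B Q_def)
      then show ?thesis using Q' by auto
    qed
    then have "card {i\<in>A. 0 < w' i} + card {j\<in>B. w' j < a - y} < card P + card Q"
    proof
      assume "{i\<in>A. 0 < w' i} \<subset> P"
      then show ?thesis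
        using psubset_card_mono finPQ card_mono[OF finPQ(2) Q'] by (intro add_less_le_mono) auto
    next
      assume "{j\<in>B. w' j < a - y} \<subset> Q"
      then show ?thesis
        using psubset_card_mono finPQ card_mono[OF finPQ(1) P'] by (intro add_le_less_mono) auto
    qed
    then show ?thesis
      using y by (intro less.hyps[of w' "a - y"] w'_nonneg w'_le w'_cross u'_ge)
        (auto simp: P_def Q_def)
  qed
  then show ?case
    unfolding w'_def u'_def
    by (rule handelman_set_subtract_clique
        [OF graph \<open>K \<subseteq> A \<union> B\<close> \<open>clique E K\<close> \<open>card K \<le> t\<close> y(1)])
qed

subsection \<open>Paths\<close>

definition path_edges :: "nat \<Rightarrow> nat \<Rightarrow> nat set set" where
  "path_edges a b = {{i, Suc i} | i. a \<le> i \<and> Suc i < b}"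

lemma path_edges_iff: "{i, j} \<in> path_edges a b \<longleftrightarrow>
    a \<le> i \<and> j = Suc i \<and> j < b \<or> a \<le> j \<and> i = Suc j \<and> i < b"
  by (auto simp: path_edges_def doubleton_eq_iff)

lemma simple_graph_path: "simple_graph {a..<b} (path_edges a b)"
  by (auto simp: simple_graph_def path_edges_def)

text \<open>Each step removes the last node \<open>b\<close> and lowers the weight of its neighbour \<open>c\<close> by
  \<open>min (w b) (w c)\<close>, which decreases the maximum weight of a stable set by exactly \<open>w b\<close>.\<close>

lemma handelman_set_path:
  assumes "a \<le> b" "\<And>i. a \<le> i \<Longrightarrow> i < b \<Longrightarrow> 0 \<le> w i"
    and "\<And>i. a \<le> i \<Longrightarrow> Suc i < b \<Longrightarrow> min (w i) (w (Suc i)) \<le> u {i, Suc i}"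
  shows "\<exists>S. stable_set {a..<b} (path_edges a b) S \<and>
    const_poly (\<Sum>i\<in>S. w i) - graph_poly {a..<b} (path_edges a b) w u \<in> handelman_set {a..<b} 2"
  using assms
proof (induction b arbitrary: w rule: dec_induct)
  case base
  have "path_edges a a = {}" by (auto simp: path_edges_def)
  then show ?case
    by (intro exI[of _ "{}"]) (simp add: graph_poly_def handelman_set_0 stable_set_def)
next
  case (step b)
  have V: "{a..<Suc b} = insert b {a..<b}" using step.hyps by auto
  have lift: "f \<in> handelman_set {a..<Suc b} 2" if "f \<in> handelman_set {a..<b} 2" for f
    using that by (rule handelman_set_mono) auto
  have gen: "(\<Prod>i\<in>I. var_poly i) * (\<Prod>i\<in>J. 1 - var_poly i) \<in> handelman_set {a..<Suc b} 2"
    if "I \<union> J \<subseteq> {a..<Suc b}" "I \<inter> J = {}" "card (I \<union> J) \<le> 2" for I J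
    using that by (intro handelman_set_generator) auto
  show ?case
  proof (cases "a = b")
    case True
    then have "path_edges a (Suc b) = {}" by (auto simp: path_edges_def)
    moreover have "const_poly (w b) * (1 - var_poly b) \<in> handelman_set {a..<Suc b} 2"
      using gen[of "{}" "{b}"] True step.prems(1)[of b] by (intro handelman_set_scale) auto
    ultimately show ?thesis using True
      by (intro exI[of _ "{b}"]) (simp add: graph_poly_def stable_set_def algebra_simps)
  next
    case False
    then obtain c where c: "b = Suc c" "a \<le> c"
      using step.hyps by (cases b) auto
    define y where "y = min (w b) (w c)"
    define w' where "w' = w(c := w c - y)"
    have y: "0 \<le> y" "y \<le> w b" "y \<le> w c" "y \<le> u {b, c}"
      using step.prems(1)[of b] step.prems(1)[of c] step.prems(2)[of c] c
      by (auto simp: y_def insert_commute min.commute)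
    have "\<exists>S. stable_set {a..<b} (path_edges a b) S \<and>
      const_poly (\<Sum>i\<in>S. w' i) - graph_poly {a..<b} (path_edges a b) w' u
        \<in> handelman_set {a..<b} 2"
    proof (rule step.IH)
      show "0 \<le> w' i" if "a \<le> i" "i < b" for i
        using that step.prems(1)[of i] y by (auto simp: w'_def)
      show "min (w' i) (w' (Suc i)) \<le> u {i, Suc i}" if "a \<le> i" "Suc i < b" for i
        using step.prems(2)[of i] that y c by (auto simp: w'_def)
    qed
    then obtain S where S: "stable_set {a..<b} (path_edges a b) S" and
      mem: "const_poly (\<Sum>i\<in>S. w' i) - graph_poly {a..<b} (path_edges a b) w' u
        \<in> handelman_set {a..<b} 2"
      by blast
    have "finite S" "b \<notin> S"
      using S finite_subset by (fastforce simp: stable_set_def)+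
    \<comment> \<open>If \<open>c \<in> S\<close> and \<open>w b < w c\<close>, then
      \<open>y = w b\<close>, and restoring the weight of \<open>c\<close> already gains
      \<open>w b\<close>. Otherwise \<open>c\<close> is not in \<open>S\<close> or
      \<open>w' c = 0\<close>, so exchanging \<open>c\<close> for \<open>b\<close> loses
      nothing.\<close>
    have "\<exists>S'. stable_set {a..<Suc b} (path_edges a (Suc b)) S' \<and>
      (\<Sum>i\<in>S'. w i) = (\<Sum>i\<in>S. w' i) + w b"
    proof (cases "c \<in> S \<and> w b < w c")
      case True
      have "(\<Sum>i\<in>S. w i) = (\<Sum>i\<in>S. w' i) + w b"
        using True \<open>finite S\<close> by (simp add: sum.remove[of S c] w'_def y_def)
      moreover have "stable_set {a..<Suc b} (path_edges a (Suc b)) S"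
        using S by (fastforce simp: stable_set_def path_edges_iff)
      ultimately show ?thesis by blast
    next
      case False
      have "(\<Sum>i\<in>S - {c}. w i) = (\<Sum>i\<in>S. w' i)"
        using False \<open>finite S\<close> by (intro sum.mono_neutral_cong_left) (auto simp: w'_def y_def)
      then have "(\<Sum>i\<in>insert b (S - {c}). w i) = (\<Sum>i\<in>S. w' i) + w b"
        using \<open>finite S\<close> \<open>b \<notin> S\<close> by simp
      moreover have "stable_set {a..<Suc b} (path_edges a (Suc b)) (insert b (S - {c}))"
        using S step.hyps c by (fastforce simp: stable_set_def path_edges_iff)
      ultimately show ?thesis by blast
    qed
    then obtain S' where S': "stable_set {a..<Suc b} (path_edges a (Suc b)) S'"
      "(\<Sum>i\<in>S'. w i) = (\<Sum>i\<in>S. w' i) + w b"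
      by blast
    have "induced_edges (path_edges a (Suc b)) {a..<b} = path_edges a b"
      by (auto simp: induced_edges_def path_edges_def)
    moreover have "{j\<in>{a..<b}. {b, j} \<in> path_edges a (Suc b)} = {c}"
      using c by (auto simp: path_edges_iff)
    ultimately have G: "graph_poly {a..<Suc b} (path_edges a (Suc b)) w u =
        graph_poly {a..<b} (path_edges a b) w u +
        var_poly b * (const_poly (w b) - const_poly (u {b, c}) * var_poly c)"
      using graph_poly_insert[of b "{a..<b}" "path_edges a (Suc b)" w u]
        simple_graph_path[of a "Suc b"]
      by (simp add: V)
    have "c \<in> {a..<b}" using c by auto
    then have W: "graph_poly {a..<b} (path_edges a b) w u =
        graph_poly {a..<b} (path_edges a b) w' u + const_poly y * var_poly c"
      by (simp add: graph_poly_def sum.remove[of _ c] w'_def const_poly_diff algebra_simps)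
    have "const_poly (\<Sum>i\<in>S'. w i) - graph_poly {a..<Suc b} (path_edges a (Suc b)) w u =
        (const_poly (\<Sum>i\<in>S. w' i) - graph_poly {a..<b} (path_edges a b) w' u) +
        const_poly y * ((1 - var_poly b) * (1 - var_poly c)) +
        const_poly (w b - y) * (1 - var_poly b) +
        const_poly (u {b, c} - y) * (var_poly b * var_poly c)"
      unfolding S' G W by (simp add: const_poly_add const_poly_diff algebra_simps)
    also have "\<dots> \<in> handelman_set {a..<Suc b} 2"
      using gen[of "{}" "{b, c}"] gen[of "{}" "{b}"] gen[of "{b, c}" "{}"] c y
      by (intro handelman_set_add handelman_set_scale lift[OF mem]) auto
    finally show ?thesis using S'(1) by blast
  qed
qed

subsection \<open>Odd circuits and their complements\<close>

text \<open>Ordering the two ends removes the modulus: only the closing edge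
  \<open>{0, m - 1}\<close> wraps around.\<close>

lemma circuit_edges_iff:
  assumes "3 \<le> m" "i < j" "j < m"
  shows "{i, j} \<in> circuit_edges m \<longleftrightarrow> j = Suc i \<or> i = 0 \<and> Suc j = m"
proof
  assume "{i, j} \<in> circuit_edges m"
  then obtain k where "k < m" "{i, j} = {k, (k + 1) mod m}"
    by (auto simp: circuit_edges_def)
  then show "j = Suc i \<or> i = 0 \<and> Suc j = m"
    using assms by (cases "k + 1 = m") (auto simp: doubleton_eq_iff)
next
  assume "j = Suc i \<or> i = 0 \<and> Suc j = m"
  then show "{i, j} \<in> circuit_edges m"
  proof
    assume "j = Suc i"
    then show ?thesis
      unfolding circuit_edges_def using assms by (intro CollectI exI[of _ i]) auto
  next
    assume "i = 0 \<and> Suc j = m"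
    then show ?thesis
      unfolding circuit_edges_def using assms by (intro CollectI exI[of _ j]) auto
  qed
qed

text \<open>Because \<open>b < m\<close>, the segment misses the node \<open>m - 1\<close> and with
  it the closing edge.\<close>

lemma induced_circuit_edges:
  assumes "b < m"
  shows "induced_edges (circuit_edges m) {a..<b} = path_edges a b"
proof
  show "induced_edges (circuit_edges m) {a..<b} \<subseteq> path_edges a b"
  proof
    fix e assume "e \<in> induced_edges (circuit_edges m) {a..<b}"
    then obtain k where k: "e = {k, (k + 1) mod m}" "e \<subseteq> {a..<b}"
      by (auto simp: induced_edges_def circuit_edges_def)
    then have "e = {k, Suc k}" using assms by simp
    then show "e \<in> path_edges a b" using k(2) by (simp add: path_edges_iff)
  qed
  have "{i, Suc i} \<in> circuit_edges m" if "Suc i < b" for i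
    using that assms unfolding circuit_edges_def by (intro CollectI exI[of _ i]) auto
  then show "path_edges a b \<subseteq> induced_edges (circuit_edges m) {a..<b}"
    by (auto simp: induced_edges_def path_edges_def)
qed

text \<open>Smaller graphs are certified with the weight of one of their own stable sets, whereas a
  split needs constants coming from the whole graph.\<close>

lemma handelman_set_upper_bound:
  assumes "const_poly b - p \<in> handelman_set V t" "finite V" "b \<le> a"
  shows "const_poly a - p \<in> handelman_set V t"
  using handelman_set_add[OF assms(1) handelman_set_const[of V "a - b" t]] assms
  by (simp add: const_poly_diff)

lemma edge_weights_dominateD:
  assumes "edge_weights_dominate E w u" "{i, j} \<in> E"
  shows "w i \<le> u {i, j}" "w j \<le> u {i, j}"
  using assms by (auto simp: edge_weights_dominate_def)

lemma edge_weights_nonneg: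
  assumes "edge_weights_dominate E w u" "simple_graph V E" "\<forall>i\<in>V. 0 \<le> w i" "e \<in> E"
  shows "0 \<le> u e"
  using assms(2,4)
proof (rule edge_cases)
  fix i j assume ij: "e = {i, j}" "i \<in> V"
  then have "0 \<le> w i" "w i \<le> u e"
    using assms edge_weights_dominateD(1)[of E w u i j] by auto
  then show ?thesis by (rule order_trans)
qed

text \<open>A circuit edge inside the segment is an induced edge, so the stable set of the path is
  stable in the whole circuit and its weight can be compared with the stability number
  there.\<close>

lemma handelman_set_circuit_segment:
  assumes "b < m" "\<forall>i\<in>circuit_nodes m. 0 \<le> w i" "edge_weights_dominate (circuit_edges m) w u"
  shows "\<exists>S. S \<subseteq> {a..<b} \<and> stable_set (circuit_nodes m) (circuit_edges m) S \<and>
    const_poly (\<Sum>i\<in>S. w i) - graph_poly {a..<b} (induced_edges (circuit_edges m) {a..<b}) w u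
      \<in> handelman_set {a..<b} 2"
proof (cases "a \<le> b")
  case True
  have ind: "induced_edges (circuit_edges m) {a..<b} = path_edges a b"
    using assms(1) by (rule induced_circuit_edges)
  have "\<exists>S. stable_set {a..<b} (path_edges a b) S \<and>
    const_poly (\<Sum>i\<in>S. w i) - graph_poly {a..<b} (path_edges a b) w u \<in> handelman_set {a..<b} 2"
  proof (rule handelman_set_path[OF True])
    fix i assume i: "a \<le> i" "Suc i < b"
    then have "{i, Suc i} \<in> induced_edges (circuit_edges m) {a..<b}"
      unfolding ind by (simp add: path_edges_iff)
    then show "min (w i) (w (Suc i)) \<le> u {i, Suc i}"
      using edge_weights_dominateD[OF assms(3), of i "Suc i"] by (simp add: induced_edges_def)
  qed (use assms in \<open>auto simp: circuit_nodes_def\<close>)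
  then obtain S where S: "stable_set {a..<b} (induced_edges (circuit_edges m) {a..<b}) S"
    and mem: "const_poly (\<Sum>i\<in>S. w i) -
      graph_poly {a..<b} (induced_edges (circuit_edges m) {a..<b}) w u \<in> handelman_set {a..<b} 2"
    unfolding ind by blast
  have "S \<subseteq> {a..<b}" using S by (simp add: stable_set_def)
  moreover have "stable_set (circuit_nodes m) (circuit_edges m) S"
    using S assms(1) by (fastforce simp: stable_set_def induced_edges_def circuit_nodes_def)
  ultimately show ?thesis using mem by blast
next
  case False
  then have "path_edges a b = {}" "{a..<b} = {}" by (auto simp: path_edges_def)
  moreover have "induced_edges (circuit_edges m) {a..<b} = path_edges a b"
    using assms(1) by (rule induced_circuit_edges)
  ultimately show ?thesis
    by (intro exI[of _ "{}"]) (simp add: stable_set_def graph_poly_def handelman_set_0)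
qed

text \<open>Splitting at the last node \<open>2 * n\<close> keeps both smaller graphs intervals:
  \<open>{0..<2 * n}\<close>, and \<open>{1..<2 * n - 1}\<close> once the neighbours 0 and
  \<open>2 * n - 1\<close> are removed too.\<close>

lemma handelman_set_odd_circuit:
  assumes "n \<ge> 1" "V = circuit_nodes (2 * n + 1)" "C = circuit_edges (2 * n + 1)"
    and nonneg: "\<forall>i\<in>V. 0 \<le> w i" and dom: "edge_weights_dominate C w u"
  shows "const_poly (stability_number V C w) - graph_poly V C w u \<in> handelman_set V 3"
proof -
  define v where "v = 2 * n"
  have V: "V = insert v {0..<v}" by (auto simp: assms(2) circuit_nodes_def v_def)
  have graph: "simple_graph V C" using simple_graph_circuit assms by simp
  have fin: "finite V" using graph by (simp add: simple_graph_def)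
  let ?a = "stability_number V C w"
  define N where "N = {j\<in>{0..<v}. {v, j} \<in> C}"
  have adj: "{v, j} \<in> C \<longleftrightarrow> v = Suc j \<or> j = 0" if "j < v" for j
    using circuit_edges_iff[of "2 * n + 1" j v] that assms(1)
    by (auto simp: assms(3) v_def insert_commute)
  have rest: "{0..<v} - N = {1..<v - 1}"
    by (auto simp: N_def adj)
  have segment: "\<exists>S. S \<subseteq> {a..<b} \<and> stable_set V C S \<and>
      const_poly (\<Sum>i\<in>S. w i) - graph_poly {a..<b} (induced_edges C {a..<b}) w u
        \<in> handelman_set {a..<b} 2" if "b \<le> v" for a b
    using handelman_set_circuit_segment[of b "2 * n + 1" w u a] that nonneg dom
    by (simp add: assms(2,3) v_def)
  have "const_poly ?a - graph_poly (insert v {0..<v}) C w u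
    \<in> handelman_set (insert v {0..<v}) (Suc 2)"
  proof (rule handelman_set_vertex_split[OF _ _ N_def])
    show "w j \<le> u {v, j}" if "j \<in> N" for j
      using that edge_weights_dominateD[OF dom] by (auto simp: N_def)
    show "0 \<le> u e" if "e \<in> C" for e
      using dom graph nonneg that by (rule edge_weights_nonneg)
    from segment[of v 0] obtain S where "stable_set V C S"
      "const_poly (\<Sum>i\<in>S. w i) - graph_poly {0..<v} (induced_edges C {0..<v}) w u
        \<in> handelman_set {0..<v} 2" by auto
    then show "const_poly ?a - graph_poly {0..<v} (induced_edges C {0..<v}) w u
        \<in> handelman_set {0..<v} 2"
      using stable_set_weight_le[OF fin] by (auto intro: handelman_set_upper_bound)
    from segment[of "v - 1" 1] obtain S where S: "S \<subseteq> {1..<v - 1}" "stable_set V C S"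
      and mem: "const_poly (\<Sum>i\<in>S. w i) - graph_poly {1..<v - 1} (induced_edges C {1..<v - 1}) w u
        \<in> handelman_set {1..<v - 1} 2" by auto
    have "{v, v} \<notin> C" using graph by (force simp: simple_graph_def)
    moreover have "{v, i} \<notin> C \<and> {i, v} \<notin> C" if "i \<in> S" for i
    proof -
      have "i \<in> {1..<v - 1}" using that S(1) by blast
      then have "i < v" "v \<noteq> Suc i" "i \<noteq> 0" by auto
      then show ?thesis using adj[of i] by (simp add: insert_commute)
    qed
    \<comment> \<open>Adding \<open>v\<close> to a stable set of the inner path is what makes
      \<open>?a - w v\<close> large enough for that path.\<close>
    ultimately have stable: "stable_set V C (insert v S)"
      using S V by (auto simp: stable_set_def)
    have "w v + (\<Sum>i\<in>S. w i) \<le> ?a"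
    proof -
      have "finite S" using S(1) by (rule finite_subset) simp
      moreover have "v \<notin> S" using S(1) by fastforce
      ultimately show ?thesis
        using stable_set_weight_le[OF fin stable, of w] by simp
    qed
    then have "const_poly (?a - w v) - graph_poly {1..<v - 1} (induced_edges C {1..<v - 1}) w u
        \<in> handelman_set {1..<v - 1} 2"
      by (intro handelman_set_upper_bound[OF mem]) auto
    then show "const_poly (?a - w v) -
        graph_poly ({0..<v} - N) (induced_edges C ({0..<v} - N)) w u \<in> handelman_set {0..<v} 2"
      unfolding rest by (rule handelman_set_mono) auto
  qed (use graph V in auto)
  then show ?thesis by (simp add: V)
qed

section \<open>Complements of odd circuits\<close>

lemma complement_edges_iff:
  "{i, j} \<in> complement_edges V E \<longleftrightarrow> i \<in> V \<and> j \<in> V \<and> i \<noteq> j \<and> {i, j} \<notin> E"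
  by (auto simp: complement_edges_def card_2_iff doubleton_eq_iff)

text \<open>The circuit edges \<open>{2k, 2k + 1}\<close> partition \<open>{0..<2 * n}\<close> into
  \<open>n\<close> pairs, and a clique of the complement contains at most one node of each.\<close>

lemma clique_circuit_complement_card:
  assumes "K \<subseteq> {0..<2 * n}"
    and "clique (complement_edges V (circuit_edges (2 * n + 1))) K"
  shows "card K \<le> n"
proof -
  have less: "i div 2 \<noteq> j div 2" if "i \<in> K" "j \<in> K" "i < j" for i j
  proof
    assume "i div 2 = j div 2"
    with \<open>i < j\<close> have "j = Suc i" by presburger
    moreover have "{i, j} \<notin> circuit_edges (2 * n + 1)"
      using assms(2) that unfolding clique_def complement_edges_iff by (metis less_irrefl)
    moreover have "j < 2 * n" using that assms(1) by auto
    ultimately show False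
      using circuit_edges_iff[of "2 * n + 1" i j] by auto
  qed
  have "inj_on (\<lambda>i. i div 2) K"
    using less by (intro linorder_inj_onI) auto
  moreover have "(\<lambda>i. i div 2) ` K \<subseteq> {..<n}"
    using assms(1) by auto
  ultimately have "card K \<le> card {..<n}"
    by (intro card_inj_on_le) auto
  then show ?thesis by simp
qed

text \<open>Both graphs of the split are covered by two cliques: the even and the odd nodes when
  \<open>v\<close> is deleted, and the two singletons 0 and \<open>v - 1\<close> when only the
  nonneighbours of \<open>v\<close> remain.\<close>

lemma handelman_set_odd_circuit_complement:
  assumes "n \<ge> 1" "V = circuit_nodes (2 * n + 1)" "C = circuit_edges (2 * n + 1)"
    and C': "C' = complement_edges V C"
    and nonneg: "\<forall>i\<in>V. 0 \<le> w i" and dom: "edge_weights_dominate C' w u"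
  shows "const_poly (stability_number V C' w) - graph_poly V C' w u \<in> handelman_set V (Suc n)"
proof -
  define v where "v = 2 * n"
  have V: "V = insert v {0..<v}" by (auto simp: assms(2) circuit_nodes_def v_def)
  have fin: "finite V" by (simp add: V)
  have graph: "simple_graph V C'" unfolding C' using fin by (rule simple_graph_complement)
  let ?a = "stability_number V C' w"
  have adj: "{i, j} \<in> C' \<longleftrightarrow> \<not> (j = Suc i \<or> i = 0 \<and> j = v)" if "i < j" "j \<le> v" for i j
    using circuit_edges_iff[of "2 * n + 1" i j] that assms(1)
    by (auto simp: C' complement_edges_iff V assms(3) v_def)
  have loop: "{i, i} \<notin> C'" for i by (simp add: C' complement_edges_def)
  have stable: "(\<Sum>i\<in>S. w i) \<le> ?a" if "stable_set V C' S" for S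
    using fin that by (rule stable_set_weight_le)
  have single: "w i \<le> ?a" if "i \<in> V" for i
    using stable[of "{i}"] that loop by (simp add: stable_set_def)
  have pair: "w i + w j \<le> ?a" if "i \<in> V" "j \<in> V" "i \<noteq> j" "{i, j} \<notin> C'" for i j
    using stable[of "{i, j}"] that loop by (auto simp: stable_set_def insert_commute)
  have u_ge: "min (w i) (w j) \<le> u {i, j}" if "{i, j} \<in> C'" for i j
    using edge_weights_dominateD[OF dom that] by simp
  define N where "N = {j\<in>{0..<v}. {v, j} \<in> C'}"
  have adj_v: "{v, j} \<in> C' \<longleftrightarrow> \<not> (v = Suc j \<or> j = 0)" if "j < v" for j
    using adj[of j v] that by (auto simp: insert_commute)
  have rest: "{0..<v} - N = {0} \<union> {v - 1}"
  proof -
    have "2 \<le> v" using assms(1) by (simp add: v_def)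
    then show ?thesis by (auto simp: N_def adj_v)
  qed
  have size: "card K \<le> n" if "K \<subseteq> {0..<v}" "clique C' K" for K
    using clique_circuit_complement_card[of K n V] that by (simp add: C' assms(3) v_def)
  have induced_clique: "clique C' K" if "clique (induced_edges C' W) K" for K W
    using that by (auto simp: clique_def induced_edges_def)
  have "const_poly ?a - graph_poly (insert v {0..<v}) C' w u
    \<in> handelman_set (insert v {0..<v}) (Suc n)"
  proof (rule handelman_set_vertex_split[OF _ _ N_def])
    show "w j \<le> u {v, j}" if "j \<in> N" for j
      using that edge_weights_dominateD[OF dom] by (auto simp: N_def)
    show "0 \<le> u e" if "e \<in> C'" for e
      using dom graph nonneg that by (rule edge_weights_nonneg)
    show "2 \<le> n" if "induced_edges C' {0..<v} \<noteq> {}"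
    proof -
      from that obtain e where e: "e \<in> C'" "e \<subseteq> {0..<v}" by (auto simp: induced_edges_def)
      from graph e(1) obtain i j where "e = {i, j}" "i \<noteq> j" by (rule edge_cases)
      then have "clique C' e" "card e = 2"
        using e(1) by (auto simp: clique_def insert_commute)
      then show ?thesis using size[OF e(2)] by simp
    qed
    define A where "A = {i\<in>{0..<v}. even i}"
    define B where "B = {i\<in>{0..<v}. odd i}"
    have AB: "{0..<v} = A \<union> B" by (auto simp: A_def B_def)
    \<comment> \<open>Without \<open>v\<close> the closing edge is gone, and the remaining circuit
      edges join nodes of different parity.\<close>
    have parity: "{i, j} \<in> induced_edges C' {0..<v}"
      if "i < v" "j < v" "i \<noteq> j" "even i = even j" for i j
    proof -
      have "i < j \<or> j < i" using that by auto
      then have "{i, j} \<in> C'"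
        using adj[of i j] adj[of j i] that by (auto simp: insert_commute)
      then show ?thesis using that by (simp add: induced_edges_def)
    qed
    have "const_poly ?a - graph_poly (A \<union> B) (induced_edges C' (A \<union> B)) w u
        \<in> handelman_set (A \<union> B) n"
    proof (rule handelman_set_cobipartite)
      show "simple_graph (A \<union> B) (induced_edges C' (A \<union> B))"
        using graph V AB by (intro simple_graph_induced) auto
      show "clique (induced_edges C' (A \<union> B)) A" "clique (induced_edges C' (A \<union> B)) B"
        unfolding AB[symmetric] clique_def using parity by (auto simp: A_def B_def)
      show "card K \<le> n" if "K \<subseteq> A \<union> B" "clique (induced_edges C' (A \<union> B)) K" for K
        using that induced_clique size AB by metis
      show "0 \<le> ?a" using single[of v] nonneg by (force simp: V)
      show "w i + w j \<le> ?a" if "i \<in> A" "j \<in> B" "{i, j} \<notin> induced_edges C' (A \<union> B)" for i j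
      proof -
        have "i < v" "j < v" "i \<noteq> j" using that by (auto simp: A_def B_def)
        moreover from this have "{i, j} \<notin> C'"
          using that(3) by (simp add: AB[symmetric] induced_edges_def)
        ultimately show ?thesis using pair by (simp add: V)
      qed
      show "A \<inter> B = {}" by (auto simp: A_def B_def)
      show "0 \<le> w i" "w i \<le> ?a" if "i \<in> A \<union> B" for i
        using that nonneg single[of i] unfolding AB[symmetric] by (auto simp: V)
      show "min (w i) (w j) \<le> u {i, j}" if "{i, j} \<in> induced_edges C' (A \<union> B)" for i j
        using that u_ge by (simp add: induced_edges_def)
    qed
    then show "const_poly ?a - graph_poly {0..<v} (induced_edges C' {0..<v}) w u
        \<in> handelman_set {0..<v} n"
      by (simp add: AB)
    have v: "0 < v - 1" "v - 1 < v" "{0} \<union> {v - 1} \<subseteq> {0..<v}"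
      using assms(1) by (auto simp: v_def)
    have pair_v: "w v + w i \<le> ?a" if "i \<in> {0} \<union> {v - 1}" for i
      using pair[of v i] adj_v[of i] that v by (auto simp: V)
    have "const_poly (?a - w v) -
        graph_poly ({0} \<union> {v - 1}) (induced_edges C' ({0} \<union> {v - 1})) w u
        \<in> handelman_set ({0} \<union> {v - 1}) n"
    proof (rule handelman_set_cobipartite)
      show "simple_graph ({0} \<union> {v - 1}) (induced_edges C' ({0} \<union> {v - 1}))"
        using graph V v by (intro simple_graph_induced) auto
      show "card K \<le> n" if "K \<subseteq> {0} \<union> {v - 1}"
        "clique (induced_edges C' ({0} \<union> {v - 1})) K" for K
        using that induced_clique size v(3) by (meson subset_trans)
      show "0 \<le> ?a - w v" using single[of v] by (simp add: V)
      show "w i \<le> ?a - w v" if "i \<in> {0} \<union> {v - 1}" for i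
        using pair_v[OF that] by simp
      show "w i + w j \<le> ?a - w v" if ij: "i \<in> {0}" "j \<in> {v - 1}"
        "{i, j} \<notin> induced_edges C' ({0} \<union> {v - 1})" for i j
      proof -
        \<comment> \<open>This happens only for the triangle, \<open>n = 1\<close>, whose complement
          is edgeless; the three nodes then form a stable set.\<close>
        have "{0, v - 1} \<notin> C'" using ij by (simp add: induced_edges_def)
        moreover have "{v, 0} \<notin> C'" "{v, v - 1} \<notin> C'"
          using adj_v v by auto
        ultimately have "{0, v - 1} \<notin> C'" "{v - 1, 0} \<notin> C'" "{v, 0} \<notin> C'" "{0, v} \<notin> C'"
          "{v, v - 1} \<notin> C'" "{v - 1, v} \<notin> C'" by (simp_all add: insert_commute)
        then have "stable_set V C' {v, 0, v - 1}"
          using loop v unfolding stable_set_def V by simp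
        from stable[OF this] show ?thesis using ij v by simp
      qed
      show "min (w i) (w j) \<le> u {i, j}"
        if "{i, j} \<in> induced_edges C' ({0} \<union> {v - 1})" for i j
        using that u_ge by (simp add: induced_edges_def)
    qed (use nonneg V v in \<open>auto simp: clique_def\<close>)
    then show "const_poly (?a - w v) -
        graph_poly ({0..<v} - N) (induced_edges C' ({0..<v} - N)) w u \<in> handelman_set {0..<v} n"
      unfolding rest by (rule handelman_set_mono) (use v(3) in auto)
  qed (use graph V assms(1) in auto)
  then show ?thesis by (simp add: V)
qed

section \<open>Unweighted stability numbers and the equalities\<close>

lemma stability_number_odd_circuit_le:
  assumes "n \<ge> 1"
  shows "stability_number (circuit_nodes (2 * n + 1)) (circuit_edges (2 * n + 1)) (\<lambda>_. 1) \<le> real n"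
proof -
  let ?m = "2 * n + 1"
  have "finite (circuit_nodes ?m)" by (simp add: circuit_nodes_def)
  then obtain S where S: "stable_set (circuit_nodes ?m) (circuit_edges ?m) S" and
    eq: "stability_number (circuit_nodes ?m) (circuit_edges ?m) (\<lambda>_. 1) = (\<Sum>i\<in>S. 1)"
    by (rule stability_number_attained)
  have sub: "S \<subseteq> {0..<?m}" using S by (simp add: stable_set_def circuit_nodes_def)
  then have fin: "finite S" by (rule finite_subset) simp
  \<comment> \<open>The successor map sends a stable set to a disjoint set of the same size, so
    \<open>2 * card S \<le> 2 * n + 1\<close>.\<close>
  let ?s = "\<lambda>i. (i + 1) mod ?m"
  have "inj_on ?s S"
  proof (rule inj_onI)
    fix i j assume "i \<in> S" "j \<in> S" and eq: "?s i = ?s j"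
    then have "i < ?m" "j < ?m" using sub by auto
    then show "i = j"
      using eq by (cases "i + 1 = ?m"; cases "j + 1 = ?m") auto
  qed
  moreover have "S \<inter> ?s ` S = {}"
  proof (rule ccontr)
    assume "S \<inter> ?s ` S \<noteq> {}"
    then obtain i where i: "i \<in> S" "?s i \<in> S" by blast
    then have "i < ?m" using sub by auto
    then have "{i, ?s i} \<in> circuit_edges ?m" unfolding circuit_edges_def by blast
    then show False using S i unfolding stable_set_def by blast
  qed
  ultimately have "2 * card S = card (S \<union> ?s ` S)"
    using fin by (simp add: card_Un_disjoint card_image)
  also have "\<dots> \<le> card {0..<?m}"
    using sub by (intro card_mono) auto
  finally show ?thesis unfolding eq by simp
qed

text \<open>A stable set of the complement is a clique of the circuit, and a circuit of length at
  least 5 contains no triangle.\<close>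

lemma stability_number_odd_circuit_complement_le:
  assumes "n \<ge> 2" "V = circuit_nodes (2 * n + 1)"
  shows "stability_number V (complement_edges V (circuit_edges (2 * n + 1))) (\<lambda>_. 1) \<le> 2"
proof -
  let ?C = "circuit_edges (2 * n + 1)"
  have "finite V" by (simp add: assms(2) circuit_nodes_def)
  then obtain S where S: "stable_set V (complement_edges V ?C) S" and
    eq: "stability_number V (complement_edges V ?C) (\<lambda>_. 1) = (\<Sum>i\<in>S. 1)"
    by (rule stability_number_attained)
  have adj: "j = Suc i \<or> i = 0 \<and> j = 2 * n" if "i \<in> S" "j \<in> S" "i < j" for i j
  proof -
    have "i \<in> V" "j \<in> V" "{i, j} \<in> ?C"
      using S that by (auto simp: stable_set_def complement_edges_iff)
    then show ?thesis
      using circuit_edges_iff[of "2 * n + 1" i j] that assms by (simp add: circuit_nodes_def)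
  qed
  have "card S \<le> 2"
  proof (rule ccontr)
    assume "\<not> card S \<le> 2"
    then obtain T where "T \<subseteq> S" "card T = 3"
      using obtain_subset_with_card_n[of 3 S] by auto
    then obtain a b c where "a \<in> S" "b \<in> S" "c \<in> S" "a < b" "b < c"
      by (auto simp: card_3_iff) (metis linorder_neqE_nat)
    moreover have "c \<le> 2 * n"
      using S \<open>c \<in> S\<close> by (auto simp: stable_set_def assms(2) circuit_nodes_def)
    ultimately show False
      using adj[of a b] adj[of b c] adj[of a c] assms(1) by auto
  qed
  then show ?thesis unfolding eq by simp
qed

theorem proposition6:
  fixes n :: nat and V :: "nat set" and C C' :: "nat set set"
  assumes "n \<ge> 1"
    and "V = circuit_nodes (2 * n + 1)"
    and "C = circuit_edges (2 * n + 1)"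
    and "C' = complement_edges V C"
  shows "(\<forall>w u. (\<forall>i\<in>V. 0 \<le> w i) \<and> edge_weights_dominate C w u \<longrightarrow>
             handelman_rank V C w u \<le> 3)
       \<and> (\<forall>w u. (\<forall>i\<in>V. 0 \<le> w i) \<and> edge_weights_dominate C' w u \<longrightarrow>
             handelman_rank V C' w u \<le> enat (n + 1))
       \<and> handelman_rank V C (\<lambda>_. 1) (\<lambda>_. 1) = 3
       \<and> (n \<ge> 2 \<longrightarrow> handelman_rank V C' (\<lambda>_. 1) (\<lambda>_. 1) = enat (n + 1))"
proof -
  have graph: "simple_graph V C" using simple_graph_circuit assms by simp
  then have graph': "simple_graph V C'"
    unfolding assms(4) by (intro simple_graph_complement) (simp add: simple_graph_def)
  have card: "card V = 2 * n + 1" by (simp add: assms(2) circuit_nodes_def)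
  have upper: "handelman_rank V C w u \<le> 3"
    if "\<forall>i\<in>V. 0 \<le> w i" "edge_weights_dominate C w u" for w u
    using handelman_rank_le[OF graph _ handelman_set_odd_circuit[OF assms(1-3) that]]
    by (simp add: numeral_eq_enat)
  have upper': "handelman_rank V C' w u \<le> enat (n + 1)"
    if "\<forall>i\<in>V. 0 \<le> w i" "edge_weights_dominate C' w u" for w u
    using handelman_rank_le[OF graph' _ handelman_set_odd_circuit_complement[OF assms that]]
    by simp
  have "enat 3 \<le> handelman_rank V C (\<lambda>_. 1) (\<lambda>_. 1)"
  proof (rule handelman_rank_ge[OF graph])
    fix t assume "real (card V) \<le> real t * stability_number V C (\<lambda>_. 1)"
    also have "\<dots> \<le> real t * real n"
      using stability_number_odd_circuit_le[OF assms(1)]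
      by (intro mult_left_mono) (simp_all add: assms(2,3))
    finally have "real (2 * n + 1) \<le> real (t * n)" by (simp add: card)
    \<comment> \<open>The bound \<open>t \<ge> 2 + 1/n\<close> is strictly above 2, and integrality
      raises it to 3.\<close>
    then have "2 * n < t * n" by linarith
    then show "3 \<le> t" by simp
  qed
  \<comment> \<open>For \<open>n = 1\<close> the complement has no edges and rank 1, so the equality
    starts at \<open>n = 2\<close>.\<close>
  moreover have "enat (n + 1) \<le> handelman_rank V C' (\<lambda>_. 1) (\<lambda>_. 1)" if "n \<ge> 2"
  proof (rule handelman_rank_ge[OF graph'])
    fix t assume "real (card V) \<le> real t * stability_number V C' (\<lambda>_. 1)"
    also have "\<dots> \<le> real t * 2"
      using stability_number_odd_circuit_complement_le[OF that assms(2)]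
      by (intro mult_left_mono) (simp_all add: assms(3,4))
    \<comment> \<open>Here \<open>t \<ge> n + 1/2\<close>, which rounds up to
      \<open>n + 1\<close>.\<close>
    finally show "n + 1 \<le> t" by (simp add: card)
  qed
  moreover have "edge_weights_dominate E (\<lambda>_. 1) (\<lambda>_. 1)" for E :: "nat set set"
    by (simp add: edge_weights_dominate_def)
  ultimately have "handelman_rank V C (\<lambda>_. 1) (\<lambda>_. 1) = 3"
    and "n \<ge> 2 \<longrightarrow> handelman_rank V C' (\<lambda>_. 1) (\<lambda>_. 1) = enat (n + 1)"
    using upper[of "\<lambda>_. 1" "\<lambda>_. 1"] upper'[of "\<lambda>_. 1" "\<lambda>_. 1"]
    by (simp_all add: numeral_eq_enat order_antisym)
  then show ?thesis using upper upper' by blast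
qed

end
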